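(* For $n\ge 1$ let $a_n = |S_n^2(132,213,321)|$. Then $a_{n} = n^2$ for all $n\ge 1$.
   Context: A $3$-permutation of size $n$ is an ordered pair $(\sigma,\sigma')$ of permutations of $[n]=\{1,\dots,n\}$. A (classical) permutation $\tau\in S_n$ contains a pattern $\pi\in S_k$ if there are indices $c_1<\dots<c_k$ such that $\tau(c_1)\cdots\tau(c_k)$ is order-isomorphic to $\pi$, and avoids $\pi$ otherwise. A $3$-permutation $(\sigma,\sigma')$ avoids a pattern $\pi\in S_k$ if each of the three permutations $\sigma$, $\sigma'$, and $\sigma'\circ\sigma^{-1}$ (where $(\sigma'\circ\sigma^{-1})(i)=\sigma'(\sigma^{-1}(i))$) avoids $\pi$. $S_n^2(\pi_1,\dots,\pi_m)$ denotes the set of $3$-permutations of size $n$ avoiding each of $\pi_1,\dots,\pi_m$. Patterns are written in one-line notation. *)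

theory Defs
  imports "HOL-Combinatorics.Permutations"
begin

text \<open>
  A permutation of $[n]$ is a function \<open>\<tau> :: nat \<Rightarrow> nat\<close> with \<open>\<tau> permutes {1..n}\<close>; such a
  function is the identity outside \<open>{1..n}\<close>, so equality of functions is equality of
  permutations and \<open>inv\<close> is the inverse permutation.

  A pattern $\pi \in S_k$ is the list \<open>[\<pi>(1), \<dots>, \<pi>(k)]\<close> (one-line notation), so list
  positions are counted from 0 while positions in $[n]$ are counted from 1.
\<close>

definition contains_pattern :: "nat \<Rightarrow> (nat \<Rightarrow> nat) \<Rightarrow> nat list \<Rightarrow> bool" where
  "contains_pattern n \<tau> \<pi> \<longleftrightarrow>
     (\<exists>c :: nat \<Rightarrow> nat.
        strict_mono_on {..<length \<pi>} c \<and>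
        c ` {..<length \<pi>} \<subseteq> {1..n} \<and>
        (\<forall>i<length \<pi>. \<forall>j<length \<pi>. \<tau> (c i) < \<tau> (c j) \<longleftrightarrow> \<pi> ! i < \<pi> ! j))"

definition avoids_pattern :: "nat \<Rightarrow> (nat \<Rightarrow> nat) \<Rightarrow> nat list \<Rightarrow> bool" where
  "avoids_pattern n \<tau> \<pi> \<longleftrightarrow> \<not> contains_pattern n \<tau> \<pi>"

definition three_permutations :: "nat \<Rightarrow> ((nat \<Rightarrow> nat) \<times> (nat \<Rightarrow> nat)) set" where
  "three_permutations n = {(\<sigma>, \<sigma>'). \<sigma> permutes {1..n} \<and> \<sigma>' permutes {1..n}}"

definition avoids3 :: "nat \<Rightarrow> (nat \<Rightarrow> nat) \<times> (nat \<Rightarrow> nat) \<Rightarrow> nat list \<Rightarrow> bool" where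
  "avoids3 n = (\<lambda>(\<sigma>, \<sigma>') \<pi>.
     avoids_pattern n \<sigma> \<pi> \<and> avoids_pattern n \<sigma>' \<pi> \<and> avoids_pattern n (\<sigma>' \<circ> inv \<sigma>) \<pi>)"

text \<open>The set $S_n^2(\pi_1, \dots, \pi_m)$, where \<open>P\<close> is the set of the patterns $\pi_i$.\<close>

definition S2 :: "nat \<Rightarrow> nat list set \<Rightarrow> ((nat \<Rightarrow> nat) \<times> (nat \<Rightarrow> nat)) set" where
  "S2 n P = {p \<in> three_permutations n. \<forall>\<pi>\<in>P. avoids3 n p \<pi>}"

end

theory Submission
  imports Defs
begin

text \<open>
  A permutation avoids 132, 213 and 321 iff every triple of positions shows one of the even
  patterns 123, 231, 312, that is, iff the permutation preserves the cyclic orientation of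
  triples. Such permutations form a group, so the condition on \<open>\<sigma>' \<circ> inv \<sigma>\<close> is automatic and
  $a_n$ is the square of the number of avoiders. An avoider is determined by the position of
  its value 1, and each position occurs (in a rotation), so there are $n$ of them.
\<close>

section \<open>Cyclic orientation of triples and the maps that preserve it\<close>

text \<open>The strict cyclic order of points on a circle: one of the three rotations of the triple
  is increasing.\<close>

definition cyclic :: "nat \<Rightarrow> nat \<Rightarrow> nat \<Rightarrow> bool" where
  "cyclic x y z \<longleftrightarrow> x < y \<and> y < z \<or> y < z \<and> z < x \<or> z < x \<and> x < y"

text \<open>Quantifying over all cyclically ordered triples, not only the increasing ones, makes the
  condition directly composable.\<close>

definition cyclic_perms :: "nat \<Rightarrow> (nat \<Rightarrow> nat) set" where
  "cyclic_perms n = {\<tau>. \<tau> permutes {1..n} \<and>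
     (\<forall>a\<in>{1..n}. \<forall>b\<in>{1..n}. \<forall>c\<in>{1..n}. cyclic a b c \<longrightarrow> cyclic (\<tau> a) (\<tau> b) (\<tau> c))}"

lemma cyclic_rotate: "cyclic x y z \<longleftrightarrow> cyclic y z x"
  by (auto simp: cyclic_def)

lemma cyclic_total: "x \<noteq> y \<Longrightarrow> y \<noteq> z \<Longrightarrow> x \<noteq> z \<Longrightarrow> cyclic x y z \<or> cyclic x z y"
  by (auto simp: cyclic_def)

lemma cyclic_distinct: "cyclic x y z \<Longrightarrow> x \<noteq> y \<and> y \<noteq> z \<and> x \<noteq> z"
  by (auto simp: cyclic_def)

lemma cyclic_asym: "cyclic x y z \<Longrightarrow> \<not> cyclic x z y"
  by (auto simp: cyclic_def)

section \<open>Avoidance of the three odd patterns as preservation of orientation\<close>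

text \<open>The comparisons with \<open>i = j\<close> hold trivially, which leaves six. Both
  directions are listed for each pair because \<open>\<tau>\<close> need not be injective
  here.\<close>

lemma contains_pattern_3:
  "contains_pattern n \<tau> [x, y, z] \<longleftrightarrow>
     (\<exists>a b c. 1 \<le> a \<and> a < b \<and> b < c \<and> c \<le> n \<and>
        (\<tau> a < \<tau> b \<longleftrightarrow> x < y) \<and> (\<tau> b < \<tau> a \<longleftrightarrow> y < x) \<and>
        (\<tau> a < \<tau> c \<longleftrightarrow> x < z) \<and> (\<tau> c < \<tau> a \<longleftrightarrow> z < x) \<and>
        (\<tau> b < \<tau> c \<longleftrightarrow> y < z) \<and> (\<tau> c < \<tau> b \<longleftrightarrow> z < y))" (is "_ \<longleftrightarrow> ?R")
proof -
  have dom: "{..<length [x, y, z]} = {0, 1, 2}"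
    by auto
  have all: "(\<forall>i<length [x, y, z]. P i) \<longleftrightarrow> P 0 \<and> P 1 \<and> P 2" for P
    by (auto simp: All_less_Suc numeral_2_eq_2)
  show ?thesis
  proof
    assume "contains_pattern n \<tau> [x, y, z]"
    then obtain f where f: "strict_mono_on {0, 1, 2::nat} f" "f ` {0, 1, 2} \<subseteq> {1..n}"
      and ord: "\<forall>i<length [x, y, z]. \<forall>j<length [x, y, z].
         \<tau> (f i) < \<tau> (f j) \<longleftrightarrow> [x, y, z] ! i < [x, y, z] ! j"
      unfolding contains_pattern_def dom by (elim exE conjE)
    have "1 \<le> f 0" "f 0 < f 1" "f 1 < f 2" "f 2 \<le> n"
      using f by (auto simp: strict_mono_on_def)
    with ord show ?R
      unfolding all by (intro exI[of _ "f 0"] exI[of _ "f 1"] exI[of _ "f 2"]) simp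
  next
    assume ?R
    then obtain a b c where abc: "1 \<le> a" "a < b" "b < c" "c \<le> n"
      and ord: "\<tau> a < \<tau> b \<longleftrightarrow> x < y" "\<tau> b < \<tau> a \<longleftrightarrow> y < x"
        "\<tau> a < \<tau> c \<longleftrightarrow> x < z" "\<tau> c < \<tau> a \<longleftrightarrow> z < x"
        "\<tau> b < \<tau> c \<longleftrightarrow> y < z" "\<tau> c < \<tau> b \<longleftrightarrow> z < y"
      by blast
    \<comment> \<open>List lookup serves as the index function; its values beyond position 2 are
      irrelevant.\<close>
    have "strict_mono_on {0, 1, 2} ((!) [a, b, c])" "(!) [a, b, c] ` {0, 1, 2} \<subseteq> {1..n}"
      using abc by (auto simp: strict_mono_on_def)
    with ord show "contains_pattern n \<tau> [x, y, z]"
      unfolding contains_pattern_def dom all by (intro exI[of _ "(!) [a, b, c]"]) simp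
  qed
qed

text \<open>Avoidance first becomes a condition on increasing triples of positions. It extends to
  all cyclically ordered triples because each is a rotation of an increasing one.\<close>

lemma avoids_iff_cyclic_perms:
  assumes "\<tau> permutes {1..n}"
  shows "(\<forall>\<pi>\<in>{[1, 3, 2], [2, 1, 3], [3, 2, 1]}. avoids_pattern n \<tau> \<pi>) \<longleftrightarrow> \<tau> \<in> cyclic_perms n"
proof -
  have inj: "\<tau> a \<noteq> \<tau> b" if "a \<noteq> b" for a b
    using permutes_inj[OF assms] that by (auto dest: injD)
  have "(\<forall>\<pi>\<in>{[1, 3, 2], [2, 1, 3], [3, 2, 1]}. avoids_pattern n \<tau> \<pi>) \<longleftrightarrow>
    (\<forall>a b c. 1 \<le> a \<and> a < b \<and> b < c \<and> c \<le> n \<longrightarrow> cyclic (\<tau> a) (\<tau> b) (\<tau> c))" (is "?L \<longleftrightarrow> ?R")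
  proof
    assume L: ?L
    show ?R
    proof (intro allI impI)
      fix a b c assume *: "1 \<le> a \<and> a < b \<and> b < c \<and> c \<le> n"
      have "\<not> contains_pattern n \<tau> [1, 3, 2]" "\<not> contains_pattern n \<tau> [2, 1, 3]"
        "\<not> contains_pattern n \<tau> [3, 2, 1]"
        using L by (simp_all add: avoids_pattern_def)
      note no = this[unfolded contains_pattern_3 not_ex, rule_format, of a b c]
      have "\<not> (\<tau> a < \<tau> c \<and> \<tau> c < \<tau> b)"
        using no(1) * by auto
      moreover have "\<not> (\<tau> b < \<tau> a \<and> \<tau> a < \<tau> c)"
        using no(2) * by auto
      moreover have "\<not> (\<tau> c < \<tau> b \<and> \<tau> b < \<tau> a)"
        using no(3) * by auto
      moreover have "\<tau> a \<noteq> \<tau> b" "\<tau> b \<noteq> \<tau> c" "\<tau> a \<noteq> \<tau> c"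
        using * by (auto intro!: inj)
      \<comment> \<open>Of the six orders of three distinct values, exactly 123, 231 and 312
        remain.\<close>
      ultimately show "cyclic (\<tau> a) (\<tau> b) (\<tau> c)"
        unfolding cyclic_def by linarith
    qed
  next
    assume R: ?R
    have "\<not> contains_pattern n \<tau> \<pi>" if "\<pi> \<in> {[1, 3, 2], [2, 1, 3], [3, 2, 1]}" for \<pi>
    proof
      assume "contains_pattern n \<tau> \<pi>"
      with that obtain a b c where abc: "1 \<le> a \<and> a < b \<and> b < c \<and> c \<le> n"
        and bad: "\<tau> a < \<tau> c \<and> \<tau> c < \<tau> b \<or> \<tau> b < \<tau> a \<and> \<tau> a < \<tau> c \<or> \<tau> c < \<tau> b \<and> \<tau> b < \<tau> a"
        by (auto simp: contains_pattern_3)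
      from R abc have "cyclic (\<tau> a) (\<tau> b) (\<tau> c)"
        by blast
      then show False
        using bad by (auto simp: cyclic_def)
    qed
    then show ?L
      by (simp add: avoids_pattern_def)
  qed
  also have "\<dots> \<longleftrightarrow> \<tau> \<in> cyclic_perms n"
  proof
    assume R: "\<forall>a b c. 1 \<le> a \<and> a < b \<and> b < c \<and> c \<le> n \<longrightarrow> cyclic (\<tau> a) (\<tau> b) (\<tau> c)"
    have "cyclic (\<tau> a) (\<tau> b) (\<tau> c)"
      if mem: "a \<in> {1..n}" "b \<in> {1..n}" "c \<in> {1..n}" and abc: "cyclic a b c" for a b c
    proof -
      consider "a < b" "b < c" | "b < c" "c < a" | "c < a" "a < b"
        using abc by (auto simp: cyclic_def)
      \<comment> \<open>In each case \<open>R\<close> applies to the rotation of the triple that is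
        increasing.\<close>
      then have "cyclic (\<tau> a) (\<tau> b) (\<tau> c) \<or> cyclic (\<tau> b) (\<tau> c) (\<tau> a) \<or> cyclic (\<tau> c) (\<tau> a) (\<tau> b)"
        using R mem by cases simp_all
      then show ?thesis
        using cyclic_rotate by blast
    qed
    then show "\<tau> \<in> cyclic_perms n"
      using assms by (simp add: cyclic_perms_def)
  next
    assume \<tau>: "\<tau> \<in> cyclic_perms n"
    show "\<forall>a b c. 1 \<le> a \<and> a < b \<and> b < c \<and> c \<le> n \<longrightarrow> cyclic (\<tau> a) (\<tau> b) (\<tau> c)"
    proof (intro allI impI)
      fix a b c assume "1 \<le> a \<and> a < b \<and> b < c \<and> c \<le> n"
      then have "cyclic a b c" "a \<in> {1..n}" "b \<in> {1..n}" "c \<in> {1..n}"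
        by (auto simp: cyclic_def)
      then show "cyclic (\<tau> a) (\<tau> b) (\<tau> c)"
        using \<tau> unfolding cyclic_perms_def by blast
    qed
  qed
  finally show ?thesis .
qed

section \<open>Closure under composition with an inverse\<close>

text \<open>The inverse preserves orientation because a distinct triple has only two orientations:
  if \<open>inv \<sigma>\<close> reversed one, applying \<open>\<sigma>\<close> would keep it
  reversed, yet it returns the original triple.\<close>

lemma cyclic_perms_comp_inv:
  assumes "\<sigma> \<in> cyclic_perms n" "\<sigma>' \<in> cyclic_perms n"
  shows "\<sigma>' \<circ> inv \<sigma> \<in> cyclic_perms n"
proof -
  have s: "\<sigma> permutes {1..n}" "\<sigma>' permutes {1..n}"
    using assms by (auto simp: cyclic_perms_def)
  note inv = permutes_inv[OF s(1)]
  have "cyclic (\<sigma>' (inv \<sigma> a)) (\<sigma>' (inv \<sigma> b)) (\<sigma>' (inv \<sigma> c))"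
    if abc: "a \<in> {1..n}" "b \<in> {1..n}" "c \<in> {1..n}" "cyclic a b c" for a b c
  proof -
    have mem: "inv \<sigma> a \<in> {1..n}" "inv \<sigma> b \<in> {1..n}" "inv \<sigma> c \<in> {1..n}"
      using abc permutes_in_image[OF inv] by blast+
    have "cyclic (inv \<sigma> a) (inv \<sigma> b) (inv \<sigma> c) \<or> cyclic (inv \<sigma> a) (inv \<sigma> c) (inv \<sigma> b)"
      using cyclic_distinct[OF abc(4)] by (intro cyclic_total) (auto dest: injD[OF permutes_inj[OF inv]])
    moreover have "\<not> cyclic (inv \<sigma> a) (inv \<sigma> c) (inv \<sigma> b)"
    proof
      assume "cyclic (inv \<sigma> a) (inv \<sigma> c) (inv \<sigma> b)"
      then have "cyclic (\<sigma> (inv \<sigma> a)) (\<sigma> (inv \<sigma> c)) (\<sigma> (inv \<sigma> b))"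
        using assms(1) mem unfolding cyclic_perms_def by blast
      then show False
        using cyclic_asym[OF abc(4)] by (simp add: permutes_inverses[OF s(1)])
    qed
    ultimately show ?thesis
      using assms(2) mem unfolding cyclic_perms_def by blast
  qed
  then show ?thesis
    using permutes_compose[OF inv s(2)] by (simp add: cyclic_perms_def)
qed

section \<open>Counting the orientation-preserving permutations\<close>

text \<open>Each value of a permutation of \<open>{1..n}\<close> is its own rank among the values,
  so the relative order determines the permutation.\<close>

lemma permutes_eqI_order:
  fixes \<sigma> \<tau> :: "nat \<Rightarrow> nat"
  assumes "\<sigma> permutes {1..n}" "\<tau> permutes {1..n}"
    and le: "\<And>i j. i \<in> {1..n} \<Longrightarrow> j \<in> {1..n} \<Longrightarrow> \<sigma> i \<le> \<sigma> j \<longleftrightarrow> \<tau> i \<le> \<tau> j"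
  shows "\<sigma> = \<tau>"
proof
  have rank: "\<rho> i = card {j \<in> {1..n}. \<rho> j \<le> \<rho> i}" if \<rho>: "\<rho> permutes {1..n}" "i \<in> {1..n}" for \<rho> i
  proof -
    have "\<rho> i \<in> {1..n}"
      using permutes_in_image[OF \<rho>(1)] \<rho>(2) by blast
    \<comment> \<open>Surjectivity onto \<open>{1..n}\<close> ensures that every number up to
      \<open>\<rho> i\<close> is attained.\<close>
    then have "{1..\<rho> i} = {k \<in> \<rho> ` {1..n}. k \<le> \<rho> i}"
      unfolding permutes_image[OF \<rho>(1)] by auto
    also have "\<dots> = \<rho> ` {j \<in> {1..n}. \<rho> j \<le> \<rho> i}"
      by auto
    finally have "card {1..\<rho> i} = card (\<rho> ` {j \<in> {1..n}. \<rho> j \<le> \<rho> i})"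
      by simp
    then show ?thesis
      using card_image[OF permutes_inj_on[OF \<rho>(1)]] by simp
  qed
  fix i
  show "\<sigma> i = \<tau> i"
  proof (cases "i \<in> {1..n}")
    case True
    then have "{j \<in> {1..n}. \<sigma> j \<le> \<sigma> i} = {j \<in> {1..n}. \<tau> j \<le> \<tau> i}"
      using le by blast
    then show ?thesis
      using rank[OF assms(1) True] rank[OF assms(2) True] by simp
  next
    case False
    then show ?thesis
      using assms(1,2) by (simp add: permutes_not_in)
  qed
qed

text \<open>As 1 is the least value, a cyclically ordered triple of values starting at 1 is
  increasing. Hence the order of the values can be read off from \<open>p\<close> alone.\<close>

lemma cyclic_perms_less_iff:
  assumes "\<tau> \<in> cyclic_perms n" "p \<in> {1..n}" "\<tau> p = 1" "i \<in> {1..n}" "j \<in> {1..n}"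
  shows "\<tau> i < \<tau> j \<longleftrightarrow> i \<noteq> j \<and> (i = p \<or> cyclic p i j)"
proof -
  have \<tau>: "\<tau> permutes {1..n}"
    using assms(1) by (simp add: cyclic_perms_def)
  have pos: "1 \<le> \<tau> i" "1 \<le> \<tau> j"
    using permutes_in_image[OF \<tau>] assms(4,5) by force+
  have min: "\<tau> k \<noteq> 1" if "k \<noteq> p" for k
    using permutes_inj[OF \<tau>] assms(3) that by (metis injD)
  have c: "cyclic (\<tau> p) (\<tau> x) (\<tau> y)" if "cyclic p x y" "x \<in> {1..n}" "y \<in> {1..n}" for x y
    using assms(1,2) that unfolding cyclic_perms_def by blast
  have lt: "\<tau> x < \<tau> y" if "cyclic p x y" "x \<in> {1..n}" "y \<in> {1..n}" for x y
  proof -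
    have "1 \<le> \<tau> x" "1 \<le> \<tau> y"
      using permutes_in_image[OF \<tau>] that(2,3) by force+
    then show ?thesis
      using c[OF that] assms(3) by (auto simp: cyclic_def)
  qed
  show ?thesis
  proof (cases "i = j \<or> i = p \<or> j = p")
    case True
    then show ?thesis
      using pos min[of i] min[of j] assms(3) by (auto simp: cyclic_def)
  next
    case False
    \<comment> \<open>The second case supplies the converse: the opposite orientation forces the
      opposite inequality.\<close>
    then consider "cyclic p i j" | "cyclic p j i"
      using cyclic_total[of p i j] by auto
    then show ?thesis
      using False lt[of i j] lt[of j i] assms(4,5) cyclic_asym[of p] by cases force+
  qed
qed

text \<open>In one-line notation this is n-p+2, ..., n, 1, ..., n-p+1, with 1 at position
  \<open>p\<close>. Adding before subtracting avoids truncation for \<open>p\<close> in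
  \<open>{1..n}\<close>.\<close>

definition rotation :: "nat \<Rightarrow> nat \<Rightarrow> nat \<Rightarrow> nat" where
  "rotation n p i = (if i \<in> {1..n} then if p \<le> i then i + 1 - p else i + n + 1 - p else i)"

lemma rotation_in_cyclic_perms:
  assumes "p \<in> {1..n}"
  shows "rotation n p \<in> cyclic_perms n"
proof -
  have "inj_on (rotation n p) {1..n}"
    using assms by (auto simp: inj_on_def rotation_def split: if_splits)
  moreover have "rotation n p ` {1..n} \<subseteq> {1..n}"
    using assms by (auto simp: rotation_def)
  ultimately have "bij_betw (rotation n p) {1..n} {1..n}"
    by (simp add: bij_betw_def endo_inj_surj)
  then have "rotation n p permutes {1..n}"
    by (rule bij_imp_permutes) (auto simp: rotation_def)
  moreover have "cyclic (rotation n p a) (rotation n p b) (rotation n p c)"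
    if mem: "a \<in> {1..n}" "b \<in> {1..n}" "c \<in> {1..n}" and abc: "cyclic a b c" for a b c
  proof -
    \<comment> \<open>Adding \<open>p\<close> clears the subtraction; linear cases remain, according
      to which positions precede \<open>p\<close>.\<close>
    have val: "rotation n p x + p = (if p \<le> x then x + 1 else x + n + 1)" if "x \<in> {1..n}" for x
      using that assms by (simp add: rotation_def)
    consider "a < b" "b < c" | "b < c" "c < a" | "c < a" "a < b"
      using abc by (auto simp: cyclic_def)
    then show ?thesis
      using val[OF mem(1)] val[OF mem(2)] val[OF mem(3)] mem unfolding cyclic_def
      by cases (simp split: if_splits; linarith)+
  qed
  ultimately show ?thesis
    by (simp add: cyclic_perms_def)
qed

text \<open>The position of the value 1 recovers \<open>p\<close>, and an orientation-preserving
  permutation agrees with the rotation that has its 1 in the same place.\<close>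

lemma bij_betw_rotation:
  assumes "n \<ge> 1"
  shows "bij_betw (rotation n) {1..n} (cyclic_perms n)"
proof (rule bij_betw_imageI)
  have one: "rotation n p p = 1" if "p \<in> {1..n}" for p
    using that by (simp add: rotation_def)
  show "inj_on (rotation n) {1..n}"
  proof (rule inj_onI)
    fix p q assume "p \<in> {1..n}" "q \<in> {1..n}" "rotation n p = rotation n q"
    then have "rotation n p p = 1" "rotation n p q = 1"
      using one[of p] one[of q] by simp_all
    moreover have "inj (rotation n p)"
      using rotation_in_cyclic_perms[OF \<open>p \<in> {1..n}\<close>] permutes_inj by (auto simp: cyclic_perms_def)
    ultimately show "p = q"
      by (metis injD)
  qed
  have "\<tau> \<in> rotation n ` {1..n}" if \<tau>: "\<tau> \<in> cyclic_perms n" for \<tau>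
  proof -
    have perm: "\<tau> permutes {1..n}"
      using \<tau> by (simp add: cyclic_perms_def)
    \<comment> \<open>Here \<open>n \<ge> 1\<close> guarantees that the value 1 exists.\<close>
    then have "1 \<in> \<tau> ` {1..n}"
      using assms by (simp add: permutes_image)
    then obtain p where p: "p \<in> {1..n}" "\<tau> p = 1"
      by auto
    note rot = rotation_in_cyclic_perms[OF p(1)]
    have "\<tau> = rotation n p"
    proof (rule permutes_eqI_order[OF perm])
      show "rotation n p permutes {1..n}"
        using rot by (simp add: cyclic_perms_def)
      show "\<tau> i \<le> \<tau> j \<longleftrightarrow> rotation n p i \<le> rotation n p j"
        if "i \<in> {1..n}" "j \<in> {1..n}" for i j
        \<comment> \<open>The indices are swapped because \<open>\<le>\<close> is treated as the
          negation of the reversed strict order.\<close>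
        using cyclic_perms_less_iff[OF \<tau> p that(2,1)]
          cyclic_perms_less_iff[OF rot p(1) one[OF p(1)] that(2,1)]
        by (simp flip: not_less)
    qed
    then show ?thesis
      using p(1) by blast
  qed
  then show "rotation n ` {1..n} = cyclic_perms n"
    using rotation_in_cyclic_perms by blast
qed

theorem theorem4p2:
  fixes n :: nat
  assumes "n \<ge> 1"
  shows "card (S2 n {[1, 3, 2], [2, 1, 3], [3, 2, 1]}) = n ^ 2"
proof -
  let ?P = "{[1, 3, 2], [2, 1, 3], [3, 2, 1]} :: nat list set"
  have iff: "(\<sigma>, \<sigma>') \<in> S2 n ?P \<longleftrightarrow> \<sigma> \<in> cyclic_perms n \<and> \<sigma>' \<in> cyclic_perms n" for \<sigma> \<sigma>'
  proof (cases "\<sigma> permutes {1..n} \<and> \<sigma>' permutes {1..n}")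
    case True
    \<comment> \<open>The avoidance criterion applies only to permutations, so this is checked for
      the third component as well.\<close>
    then have "\<sigma>' \<circ> inv \<sigma> permutes {1..n}"
      by (simp add: permutes_compose permutes_inv)
    then have "(\<sigma>, \<sigma>') \<in> S2 n ?P \<longleftrightarrow>
        \<sigma> \<in> cyclic_perms n \<and> \<sigma>' \<in> cyclic_perms n \<and> \<sigma>' \<circ> inv \<sigma> \<in> cyclic_perms n"
      using True avoids_iff_cyclic_perms[of _ n]
      unfolding S2_def three_permutations_def avoids3_def by blast
    then show ?thesis
      using cyclic_perms_comp_inv by blast
  next
    case False
    then show ?thesis
      by (auto simp: S2_def three_permutations_def cyclic_perms_def)
  qed
  have "S2 n ?P = cyclic_perms n \<times> cyclic_perms n"
    using iff by auto
  then show ?thesis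
    using bij_betw_same_card[OF bij_betw_rotation[OF assms]]
    by (simp add: card_cartesian_product power2_eq_square)
qed

end
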